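(* Fix parameters $\theta \in (0,1)$, $\beta \in (0,1)$, $\omega \in (1,\infty)$, $\gamma_1 \in [0,1)$, $\gamma_2 \in (1/\omega,1]$, $\gamma_3\in(0,1]$ with $\frac{\beta\theta}{\gamma_3(1-\beta)}+\gamma_1<1$. Then there is a constant $C>0$ depending only on $\theta,\beta,\omega,\gamma_1,\gamma_2,\gamma_3$ such that the following holds. Let $n \in \{1,2,\dots\}$, let $f:\mathbb{R}^n\to\mathbb{R}$ be twice differentiable and bounded below, let $L>0$ and suppose $\nabla^2 f$ is $L$-Lipschitz, i.e. $\|\nabla^2 f(x)-\nabla^2 f(x')\|\le L\|x-x'\|$ for all $x,x'\in\mathbb{R}^n$. Let $x_1\in\mathbb{R}^n$, $r_1\in(0,\infty)$, and suppose $\Delta_f := f(x_1)-\inf_{x\in\mathbb{R}^n} f(x)>0$. Let $(x_k,d_k,\delta_k,r_k)_{k\ge1}$ be any run of the method CAT (defined in the context) on $f$ with these parameters, started at $x_1$ with initial radius $r_1$. Then for every $\epsilon\in(0,\infty)$ there exists an iteration $k\ge 1$ with $\|\nabla f(x_k+d_k)\|\le\epsilon$ and $$k \le C\left(\frac{\Delta_f L^{1/2}}{\epsilon^{3/2}}+\log\left(\frac{\epsilon^{1/2}}{L^{1/2}r_1}+\frac{r_1\epsilon}{\Delta_f}+1\right)+1\right).$$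
   Context: $\|\cdot\|$ is the Euclidean norm on vectors and the spectral norm on matrices. The method CAT (Consistently Adaptive Trust Region Method). Given $x_1\in\mathbb{R}^n$, $r_1\in(0,\infty)$ and the parameters, a run of CAT is a sequence $(x_k,d_k,\delta_k,r_k)_{k\ge 1}$ such that for every $k\ge1$, with the quadratic model $$M_k(d):=\tfrac12 d^T\nabla^2 f(x_k)d+\nabla f(x_k)^Td,$$ (i) $d_k\in\mathbb{R}^n$ and $\delta_k\in[0,\infty)$ satisfy $$\|\nabla M_k(d_k)+\delta_k d_k\|\le\gamma_1\|\nabla f(x_k+d_k)\|,\quad \gamma_2\delta_k r_k\le\delta_k\|d_k\|,\quad \|d_k\|\le r_k,\quad M_k(d_k)\le-\gamma_3\frac{\delta_k}{2}\|d_k\|^2;$$ (ii) $x_{k+1}=x_k+d_k$ if $f(x_k+d_k)\le f(x_k)$, and $x_{k+1}=x_k$ otherwise; (iii) $r_{k+1}=\omega\|d_k\|$ if $\hat\rho_k\ge\beta$, and $r_{k+1}=\|d_k\|/\omega$ otherwise, where $$\hat\rho_k:=\frac{f(x_k)-f(x_k+d_k)}{-M_k(d_k)+\frac{\theta}{2}\|\nabla f(x_k+d_k)\|\,\|d_k\|}.$$ *)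

theory Defs
  imports Complex_Main "Jordan_Normal_Form.Matrix"
begin

text \<open>
  Points of \<open>\<real>\<^sup>n\<close> are the elements of \<^term>\<open>carrier_vec n :: real vec set\<close>: the constant of the
  complexity bound must not depend on the dimension, so \<open>n\<close> has to be quantified inside the
  formula and cannot be a type.  Functions on \<open>\<real>\<^sup>n\<close> are total functions on \<^typ>\<open>real vec\<close> of which
  only the values on \<^term>\<open>carrier_vec n :: real vec set\<close> are ever inspected.
\<close>

definition vec_norm :: "real vec \<Rightarrow> real" where
  "vec_norm v = sqrt (v \<bullet> v)"

definition spectral_norm :: "real mat \<Rightarrow> real" where
  "spectral_norm A = Sup {vec_norm (A *\<^sub>v v) | v. v \<in> carrier_vec (dim_col A) \<and> vec_norm v \<le> 1}"

text \<open>Derivatives in the sense of Frechet, represented by the gradient vector and the Jacobian matrix.\<close>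

definition has_gradient :: "nat \<Rightarrow> (real vec \<Rightarrow> real) \<Rightarrow> real vec \<Rightarrow> real vec \<Rightarrow> bool" where
  "has_gradient n f g x \<longleftrightarrow> g \<in> carrier_vec n \<and>
     (\<forall>e>0. \<exists>s>0. \<forall>h\<in>carrier_vec n. vec_norm h < s \<longrightarrow>
        \<bar>f (x + h) - f x - g \<bullet> h\<bar> \<le> e * vec_norm h)"

definition has_jacobian :: "nat \<Rightarrow> (real vec \<Rightarrow> real vec) \<Rightarrow> real mat \<Rightarrow> real vec \<Rightarrow> bool" where
  "has_jacobian n F A x \<longleftrightarrow> A \<in> carrier_mat n n \<and>
     (\<forall>e>0. \<exists>s>0. \<forall>h\<in>carrier_vec n. vec_norm h < s \<longrightarrow>
        vec_norm (F (x + h) - F x - A *\<^sub>v h) \<le> e * vec_norm h)"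

definition gradient :: "nat \<Rightarrow> (real vec \<Rightarrow> real) \<Rightarrow> real vec \<Rightarrow> real vec" where
  "gradient n f x = (THE g. has_gradient n f g x)"

definition hessian :: "nat \<Rightarrow> (real vec \<Rightarrow> real) \<Rightarrow> real vec \<Rightarrow> real mat" where
  "hessian n f x = (THE A. has_jacobian n (gradient n f) A x)"

definition twice_differentiable :: "nat \<Rightarrow> (real vec \<Rightarrow> real) \<Rightarrow> bool" where
  "twice_differentiable n f \<longleftrightarrow>
     (\<forall>x\<in>carrier_vec n. \<exists>g. has_gradient n f g x) \<and>
     (\<forall>x\<in>carrier_vec n. \<exists>A. has_jacobian n (gradient n f) A x)"

definition lipschitz_hessian :: "nat \<Rightarrow> real \<Rightarrow> (real vec \<Rightarrow> real) \<Rightarrow> bool" where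
  "lipschitz_hessian n L f \<longleftrightarrow>
     (\<forall>x\<in>carrier_vec n. \<forall>y\<in>carrier_vec n.
        spectral_norm (hessian n f x - hessian n f y) \<le> L * vec_norm (x - y))"

definition quad_model :: "nat \<Rightarrow> (real vec \<Rightarrow> real) \<Rightarrow> real vec \<Rightarrow> real vec \<Rightarrow> real" where
  "quad_model n f x d = 1/2 * (d \<bullet> (hessian n f x *\<^sub>v d)) + gradient n f x \<bullet> d"

text \<open>
  Along a run (defined below) with \<open>\<theta> > 0\<close> and \<open>\<gamma>1 < 1\<close> the denominator can only vanish at a step for which
  \<^term>\<open>gradient n f (x + d)\<close> is zero, so the convention \<open>y / 0 = 0\<close> does not influence the
  iterations up to and including the first one at which the gradient is small.
\<close>

definition rho_hat :: "nat \<Rightarrow> (real vec \<Rightarrow> real) \<Rightarrow> real \<Rightarrow> real vec \<Rightarrow> real vec \<Rightarrow> real" where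
  "rho_hat n f \<theta> x d =
     (f x - f (x + d)) /
     (- quad_model n f x d + \<theta>/2 * vec_norm (gradient n f (x + d)) * vec_norm d)"

text \<open>The sequences start at index 1; their values at index 0 are irrelevant.\<close>

definition CAT_run ::
  "nat \<Rightarrow> (real vec \<Rightarrow> real) \<Rightarrow> real \<Rightarrow> real \<Rightarrow> real \<Rightarrow> real \<Rightarrow> real \<Rightarrow> real \<Rightarrow> real vec \<Rightarrow> real \<Rightarrow>
   (nat \<Rightarrow> real vec) \<Rightarrow> (nat \<Rightarrow> real vec) \<Rightarrow> (nat \<Rightarrow> real) \<Rightarrow> (nat \<Rightarrow> real) \<Rightarrow> bool" where
  "CAT_run n f \<theta> \<beta> \<omega> \<gamma>1 \<gamma>2 \<gamma>3 x1 r1 x d \<delta> r \<longleftrightarrow>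
     x 1 = x1 \<and> r 1 = r1 \<and>
     (\<forall>k\<ge>1.
        x k \<in> carrier_vec n \<and> d k \<in> carrier_vec n \<and> \<delta> k \<ge> 0 \<and>
        vec_norm (gradient n (quad_model n f (x k)) (d k) + \<delta> k \<cdot>\<^sub>v d k)
          \<le> \<gamma>1 * vec_norm (gradient n f (x k + d k)) \<and>
        \<gamma>2 * \<delta> k * r k \<le> \<delta> k * vec_norm (d k) \<and>
        vec_norm (d k) \<le> r k \<and>
        quad_model n f (x k) (d k) \<le> - \<gamma>3 * (\<delta> k / 2) * (vec_norm (d k))\<^sup>2 \<and>
        x (Suc k) = (if f (x k + d k) \<le> f (x k) then x k + d k else x k) \<and>
        r (Suc k) = (if rho_hat n f \<theta> (x k) (d k) \<ge> \<beta> then \<omega> * vec_norm (d k)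
                     else vec_norm (d k) / \<omega>))"

end

theory Submission
  imports Defs
begin

text \<open>
  Suppose the first \<open>K\<close> trial gradients have norm at least \<open>\<epsilon>\<close>, and put \<open>D\<^sub>k = \<parallel>d\<^sub>k\<parallel>\<close>.  By Taylor's formula a step
  with \<open>\<delta>\<^sub>k = 0\<close> or \<open>\<rho>\<^sub>k < \<beta>\<close> has \<open>D\<^sub>k \<ge> a\<close> for a length \<open>a\<close> of order \<open>(\<epsilon> / L)\<^bsup>1/2\<^esup>\<close>, while a step with
  \<open>\<rho>\<^sub>k \<ge> \<beta>\<close> decreases \<open>f\<close> by at least \<open>\<beta>\<theta>\<epsilon>D\<^sub>k/2\<close>.  While \<open>r\<^sub>k < a/\<omega>\<close>, the radius thus grows by a factor of at
  least \<open>\<omega>\<gamma>\<^sub>2 > 1\<close>; afterwards it never drops below \<open>a/\<omega>\<close> again, every successful step pays a fixed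
  amount of \<open>f\<close>, and every failed step shrinks the radius by a factor of at least \<open>\<omega>\<close>.  A potential that adds to a
  multiple of \<open>f\<close> a piecewise linear function of \<open>ln r\<^sub>k\<close> therefore drops by \<open>1\<close> in every iteration.
  The term \<open>ln (r\<^sub>1/a)\<close> in its initial value is absorbed because \<open>r\<^sub>1 (L/\<epsilon>)\<^bsup>1/2\<^esup>\<close> is the product of
  \<open>\<Delta>\<^sub>f L\<^bsup>1/2\<^esup> \<epsilon>\<^bsup>-3/2\<^esup>\<close> and \<open>r\<^sub>1 \<epsilon> / \<Delta>\<^sub>f\<close>.
\<close>

section \<open>Euclidean norm, Cauchy-Schwarz and the spectral norm\<close>

lemma scalar_prod_self: "v \<bullet> v = (\<Sum>i<dim_vec v. (v $ i)\<^sup>2)" for v :: "real vec"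
  by (simp add: scalar_prod_def power2_eq_square atLeast0LessThan)

lemma vec_norm_nonneg [simp]: "0 \<le> vec_norm v"
  by (simp add: vec_norm_def scalar_prod_self sum_nonneg)

lemma power2_vec_norm: "(vec_norm v)\<^sup>2 = v \<bullet> v"
  by (simp add: vec_norm_def scalar_prod_self sum_nonneg)

lemma vec_norm_smult [simp]: "vec_norm (c \<cdot>\<^sub>v v) = \<bar>c\<bar> * vec_norm v"
proof -
  have "(c \<cdot>\<^sub>v v) \<bullet> (c \<cdot>\<^sub>v v) = c\<^sup>2 * (v \<bullet> v)"
    by (simp add: power2_eq_square)
  then show ?thesis
    by (simp add: vec_norm_def real_sqrt_mult)
qed

lemma vec_norm_zero [simp]: "vec_norm (0\<^sub>v n) = 0"
  by (simp add: vec_norm_def)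

lemma vec_norm_eq_0: "v \<in> carrier_vec n \<Longrightarrow> vec_norm v = 0 \<Longrightarrow> v = 0\<^sub>v n"
  by (intro eq_vecI) (auto simp: vec_norm_def scalar_prod_self sum_nonneg_eq_0_iff)

text \<open>Cauchy-Schwarz: subtracting from \<open>v\<close> its orthogonal projection
  \<open>t \<cdot>\<^sub>v w\<close> leaves a vector of nonnegative squared norm.\<close>

lemma scalar_prod_abs_le:
  assumes v: "v \<in> carrier_vec n" and w: "w \<in> carrier_vec n"
  shows "\<bar>v \<bullet> w\<bar> \<le> vec_norm v * vec_norm w"
proof (cases "vec_norm w = 0")
  case True
  then show ?thesis using vec_norm_eq_0[OF w] v by simp
next
  case False
  define t where "t = (v \<bullet> w) / (w \<bullet> w)"
  have ww: "w \<bullet> w > 0"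
    using False power2_vec_norm[of w] by (metis zero_less_power2)
  have "0 \<le> (v - t \<cdot>\<^sub>v w) \<bullet> (v - t \<cdot>\<^sub>v w)"
    by (simp add: scalar_prod_self sum_nonneg)
  also have "\<dots> = v \<bullet> v - 2 * t * (v \<bullet> w) + t\<^sup>2 * (w \<bullet> w)"
    using v w by (simp add: minus_scalar_prod_distrib[of _ n] scalar_prod_minus_distrib[of _ n]
        comm_scalar_prod[of w n v] power2_eq_square algebra_simps)
  also have "\<dots> = v \<bullet> v - (v \<bullet> w)\<^sup>2 / (w \<bullet> w)"
    using ww by (simp add: t_def field_simps power2_eq_square)
  finally have "(v \<bullet> w)\<^sup>2 \<le> (v \<bullet> v) * (w \<bullet> w)"
    using ww by (simp add: field_simps)
  also have "\<dots> = (vec_norm v * vec_norm w)\<^sup>2"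
    by (simp add: power_mult_distrib power2_vec_norm)
  finally show ?thesis
    by (simp add: abs_le_square_iff[symmetric])
qed

lemma vec_norm_add:
  assumes v: "v \<in> carrier_vec n" and w: "w \<in> carrier_vec n"
  shows "vec_norm (v + w) \<le> vec_norm v + vec_norm w"
proof (rule power2_le_imp_le)
  have "(vec_norm (v + w))\<^sup>2 = (vec_norm v)\<^sup>2 + 2 * (v \<bullet> w) + (vec_norm w)\<^sup>2"
    using v w by (simp add: power2_vec_norm add_scalar_prod_distrib[of _ n]
        scalar_prod_add_distrib[of _ n] comm_scalar_prod[of w n v])
  also have "\<dots> \<le> (vec_norm v + vec_norm w)\<^sup>2"
    using scalar_prod_abs_le[OF v w] by (simp add: power2_sum)
  finally show "(vec_norm (v + w))\<^sup>2 \<le> (vec_norm v + vec_norm w)\<^sup>2" .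
qed simp

lemma vec_norm_diff:
  assumes "v \<in> carrier_vec n" "w \<in> carrier_vec n"
  shows "vec_norm (v - w) \<le> vec_norm v + vec_norm w"
proof -
  have "v - w = v + (-1) \<cdot>\<^sub>v w" using assms by auto
  then show ?thesis using vec_norm_add[of v n "(-1) \<cdot>\<^sub>v w"] assms by simp
qed

text \<open>The Frobenius norm serves as the constant, by Cauchy-Schwarz on each row. A finite bound
  makes the set under the \<open>Sup\<close> of \<open>spectral_norm\<close> bounded above and later
  controls the quadratic remainder of the model.\<close>

lemma mult_mat_vec_bounded:
  fixes A :: "real mat"
  obtains c where "\<And>v. v \<in> carrier_vec (dim_col A) \<Longrightarrow> vec_norm (A *\<^sub>v v) \<le> c * vec_norm v"
proof -
  define c where "c = (\<Sum>i<dim_row A. (vec_norm (row A i))\<^sup>2)"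
  have "vec_norm (A *\<^sub>v v) \<le> sqrt c * vec_norm v" if v: "v \<in> carrier_vec (dim_col A)" for v
  proof (rule power2_le_imp_le)
    have "(vec_norm (A *\<^sub>v v))\<^sup>2 = (\<Sum>i<dim_row A. (row A i \<bullet> v)\<^sup>2)"
      by (simp add: power2_vec_norm scalar_prod_self)
    also have "\<dots> \<le> (\<Sum>i<dim_row A. (vec_norm (row A i) * vec_norm v)\<^sup>2)"
    proof (rule sum_mono)
      fix i
      show "(row A i \<bullet> v)\<^sup>2 \<le> (vec_norm (row A i) * vec_norm v)\<^sup>2"
        using power_mono[OF scalar_prod_abs_le[OF row_carrier v], of i 2] by simp
    qed
    also have "\<dots> = c * (vec_norm v)\<^sup>2"
      by (simp add: c_def power_mult_distrib sum_distrib_right)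
    also have "\<dots> = (sqrt c * vec_norm v)\<^sup>2"
      by (simp add: power_mult_distrib c_def sum_nonneg)
    finally show "(vec_norm (A *\<^sub>v v))\<^sup>2 \<le> (sqrt c * vec_norm v)\<^sup>2" .
    show "0 \<le> sqrt c * vec_norm v"
      by (simp add: c_def sum_nonneg)
  qed
  then show ?thesis by (rule that)
qed

text \<open>A real \<open>Sup\<close> dominates its elements once the set is known to be bounded
  above; the rest is homogeneity, applied to the unit vector along \<open>v\<close>.\<close>

lemma spectral_norm_bound:
  fixes A :: "real mat"
  assumes v: "v \<in> carrier_vec (dim_col A)"
  shows "vec_norm (A *\<^sub>v v) \<le> spectral_norm A * vec_norm v"
proof (cases "vec_norm v = 0")
  case True
  obtain c where "vec_norm (A *\<^sub>v v) \<le> c * vec_norm v"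
    using mult_mat_vec_bounded[of A] v by metis
  then show ?thesis using True by simp
next
  case False
  let ?S = "{vec_norm (A *\<^sub>v v) | v. v \<in> carrier_vec (dim_col A) \<and> vec_norm v \<le> 1}"
  obtain c where c: "\<And>v. v \<in> carrier_vec (dim_col A) \<Longrightarrow> vec_norm (A *\<^sub>v v) \<le> c * vec_norm v"
    using mult_mat_vec_bounded[of A] by metis
  have bdd: "bdd_above ?S"
  proof (rule bdd_aboveI)
    fix y assume "y \<in> ?S"
    then obtain w where w: "w \<in> carrier_vec (dim_col A)" "vec_norm w \<le> 1" "y = vec_norm (A *\<^sub>v w)"
      by blast
    have "y \<le> c * vec_norm w" using c w by simp
    also have "\<dots> \<le> \<bar>c\<bar> * 1" by (rule mult_mono) (use w in auto)
    finally show "y \<le> \<bar>c\<bar>" by simp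
  qed
  define u where "u = (1 / vec_norm v) \<cdot>\<^sub>v v"
  have pos: "vec_norm v > 0" using False vec_norm_nonneg[of v] by linarith
  have u: "u \<in> carrier_vec (dim_col A)" "vec_norm u \<le> 1"
    using v pos by (auto simp: u_def)
  have "vec_norm (A *\<^sub>v u) \<le> spectral_norm A"
    unfolding spectral_norm_def by (rule cSup_upper[OF _ bdd]) (use u in blast)
  moreover have "A *\<^sub>v u = (1 / vec_norm v) \<cdot>\<^sub>v (A *\<^sub>v v)"
    unfolding u_def by (rule mult_mat_vec[of _ "dim_row A"]) (use v in auto)
  ultimately show ?thesis using pos by (simp add: field_simps)
qed

section \<open>Gradients and Jacobians: restriction to lines and uniqueness\<close>

lemma has_gradientD: "has_gradient n f g x \<Longrightarrow> g \<in> carrier_vec n"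
  by (simp add: has_gradient_def)

text \<open>Restricting to a line turns the vector derivative into an ordinary real one, so that
  monotonicity arguments on the real line become available.\<close>

lemma has_gradient_directional_derivative:
  assumes g: "has_gradient n f g (x + t \<cdot>\<^sub>v d)" and x: "x \<in> carrier_vec n" and d: "d \<in> carrier_vec n"
  shows "((\<lambda>s. f (x + s \<cdot>\<^sub>v d)) has_real_derivative g \<bullet> d) (at t)"
  unfolding DERIV_def LIM_eq
proof (intro allI impI)
  fix r :: real assume r: "0 < r"
  \<comment> \<open>The summand 1 keeps \<open>r / N\<close> meaningful for \<open>d = 0\<close> and
    makes the final inequality strict.\<close>
  define N where "N = vec_norm d + 1"
  have N: "N > 0" "vec_norm d < N" by (simp_all add: N_def add_nonneg_pos)
  obtain s where s: "s > 0" and sb: "\<And>h. h \<in> carrier_vec n \<Longrightarrow> vec_norm h < s \<Longrightarrow>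
      \<bar>f (x + t \<cdot>\<^sub>v d + h) - f (x + t \<cdot>\<^sub>v d) - g \<bullet> h\<bar> \<le> r / N * vec_norm h"
    using g r N unfolding has_gradient_def by (meson divide_pos_pos)
  show "\<exists>s>0. \<forall>h. h \<noteq> 0 \<and> norm (h - 0) < s \<longrightarrow>
     norm ((f (x + (t + h) \<cdot>\<^sub>v d) - f (x + t \<cdot>\<^sub>v d)) / h - g \<bullet> d) < r"
  proof (intro exI[of _ "s / N"] conjI allI impI)
    fix h :: real assume h: "h \<noteq> 0 \<and> norm (h - 0) < s / N"
    let ?v = "f (x + (t + h) \<cdot>\<^sub>v d) - f (x + t \<cdot>\<^sub>v d)"
    have "\<bar>h\<bar> * vec_norm d \<le> \<bar>h\<bar> * N" using N by (intro mult_left_mono) auto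
    also have "\<dots> < s" using h N by (simp add: field_simps)
    finally have "\<bar>h\<bar> * vec_norm d < s" .
    then have "\<bar>f (x + t \<cdot>\<^sub>v d + h \<cdot>\<^sub>v d) - f (x + t \<cdot>\<^sub>v d) - g \<bullet> (h \<cdot>\<^sub>v d)\<bar> \<le> r / N * (\<bar>h\<bar> * vec_norm d)"
      using sb[of "h \<cdot>\<^sub>v d"] d by simp
    moreover have "x + t \<cdot>\<^sub>v d + h \<cdot>\<^sub>v d = x + (t + h) \<cdot>\<^sub>v d"
      using x d by (intro eq_vecI) (auto simp: algebra_simps)
    moreover have "g \<bullet> (h \<cdot>\<^sub>v d) = h * (g \<bullet> d)" using d has_gradientD[OF g] by simp
    ultimately have "\<bar>?v - h * (g \<bullet> d)\<bar> \<le> r / N * (\<bar>h\<bar> * vec_norm d)" by simp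
    also have "\<dots> < r / N * (\<bar>h\<bar> * N)"
      using r N h by (intro mult_strict_left_mono) auto
    also have "\<dots> = r * \<bar>h\<bar>" using N by simp
    finally have "\<bar>?v - h * (g \<bullet> d)\<bar> / \<bar>h\<bar> < r" using h by (simp add: divide_less_eq)
    moreover have "?v / h - g \<bullet> d = (?v - h * (g \<bullet> d)) / h" using h by (simp add: field_simps)
    ultimately show "norm (?v / h - g \<bullet> d) < r" by (simp add: abs_divide)
  qed (use s N in simp)
qed

text \<open>Equal directional derivatives along \<open>g - g'\<close> make that vector orthogonal to
  itself. This gives the \<open>THE\<close> in \<open>gradient\<close> its meaning.\<close>

lemma has_gradient_unique:
  assumes g: "has_gradient n f g x" and g': "has_gradient n f g' x" and x: "x \<in> carrier_vec n"
  shows "g = g'"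
proof -
  have c: "g \<in> carrier_vec n" "g' \<in> carrier_vec n" using g g' by (auto dest: has_gradientD)
  have "g \<bullet> d = g' \<bullet> d" if d: "d \<in> carrier_vec n" for d
  proof -
    have "x + 0 \<cdot>\<^sub>v d = x" using x d by auto
    then show ?thesis
      using has_gradient_directional_derivative[of n f _ x 0 d] g g' x d DERIV_unique by metis
  qed
  from this[of "g - g'"] have "(g - g') \<bullet> (g - g') = 0"
    using c by (simp add: minus_scalar_prod_distrib[of _ n])
  then have "vec_norm (g - g') = 0" by (simp add: vec_norm_def)
  then have "g - g' = 0\<^sub>v n" using c vec_norm_eq_0 by (metis minus_carrier_vec)
  then have "\<And>i. i < n \<Longrightarrow> (g - g') $ i = 0" by simp
  then show ?thesis using c by (intro eq_vecI) auto
qed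

lemma gradient_eq:
  "has_gradient n f g x \<Longrightarrow> x \<in> carrier_vec n \<Longrightarrow> gradient n f x = g"
  unfolding gradient_def by (rule the_equality, assumption, rule has_gradient_unique)

text \<open>Pairing with a fixed \<open>w\<close> makes a vector-valued map scalar, which serves
  both the uniqueness of Jacobians and Taylor's formula for the gradient. The transpose appears when
  \<open>w \<bullet> (A *\<^sub>v h)\<close> is rewritten as a product with
  \<open>h\<close>.\<close>

lemma has_jacobian_component:
  assumes A: "has_jacobian n F A x" and x: "x \<in> carrier_vec n" and w: "w \<in> carrier_vec n"
    and F: "\<And>y. y \<in> carrier_vec n \<Longrightarrow> F y \<in> carrier_vec n"
  shows "has_gradient n (\<lambda>y. w \<bullet> F y) (A\<^sup>T *\<^sub>v w) x"
  unfolding has_gradient_def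
proof (intro conjI allI impI)
  have Ac: "A \<in> carrier_mat n n" using A by (simp add: has_jacobian_def)
  then show "A\<^sup>T *\<^sub>v w \<in> carrier_vec n" using w by simp
  fix e :: real assume e: "0 < e"
  define N where "N = vec_norm w + 1"
  have N: "N > 0" "vec_norm w \<le> N" by (simp_all add: N_def add_nonneg_pos)
  obtain s where s: "s > 0" and sb: "\<And>h. h \<in> carrier_vec n \<Longrightarrow> vec_norm h < s \<Longrightarrow>
      vec_norm (F (x + h) - F x - A *\<^sub>v h) \<le> e / N * vec_norm h"
    using A e N unfolding has_jacobian_def by (meson divide_pos_pos)
  show "\<exists>s>0. \<forall>h\<in>carrier_vec n. vec_norm h < s \<longrightarrow>
      \<bar>w \<bullet> F (x + h) - w \<bullet> F x - (A\<^sup>T *\<^sub>v w) \<bullet> h\<bar> \<le> e * vec_norm h"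
  proof (intro exI[of _ s] conjI ballI impI)
    fix h assume h: "h \<in> carrier_vec n" "vec_norm h < s"
    have Fc: "F (x + h) \<in> carrier_vec n" "F x \<in> carrier_vec n" "A *\<^sub>v h \<in> carrier_vec n"
      using F x h Ac by auto
    have "w \<bullet> F (x + h) - w \<bullet> F x - (A\<^sup>T *\<^sub>v w) \<bullet> h = w \<bullet> (F (x + h) - F x - A *\<^sub>v h)"
      using Fc w h Ac transpose_vec_mult_scalar[OF Ac h(1) w]
      by (simp add: scalar_prod_minus_distrib[of _ n])
    also have "\<bar>\<dots>\<bar> \<le> vec_norm w * vec_norm (F (x + h) - F x - A *\<^sub>v h)"
      by (rule scalar_prod_abs_le[OF w]) (use Fc in simp)
    also have "\<dots> \<le> N * (e / N * vec_norm h)"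
      using N sb[OF h] by (intro mult_mono) auto
    also have "\<dots> = e * vec_norm h" using N by simp
    finally show "\<bar>w \<bullet> F (x + h) - w \<bullet> F x - (A\<^sup>T *\<^sub>v w) \<bullet> h\<bar> \<le> e * vec_norm h" .
  qed (rule s)
qed

lemma has_jacobian_unique:
  assumes A: "has_jacobian n F A x" and B: "has_jacobian n F B x" and x: "x \<in> carrier_vec n"
    and F: "\<And>y. y \<in> carrier_vec n \<Longrightarrow> F y \<in> carrier_vec n"
  shows "A = B"
proof -
  have c: "A \<in> carrier_mat n n" "B \<in> carrier_mat n n" using A B by (auto simp: has_jacobian_def)
  have eq: "A\<^sup>T *\<^sub>v w = B\<^sup>T *\<^sub>v w" if "w \<in> carrier_vec n" for w
    using has_jacobian_component[OF A x that F] has_jacobian_component[OF B x that F] x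
    by (rule has_gradient_unique)
  have "A $$ (i, j) = B $$ (i, j)" if "i < n" "j < n" for i j
    using arg_cong[OF eq[of "unit_vec n i"], of "\<lambda>v. v $ j"] that c by simp
  then show ?thesis using c by (intro eq_matI) auto
qed

section \<open>Taylor estimates along segments and symmetry of the Hessian\<close>

text \<open>The monomial with derivative \<open>c * t ^ m\<close>, plus or minus \<open>h\<close>,
  has nonnegative derivative and is therefore nondecreasing. This replaces integration of
  \<open>h'\<close> in the two Taylor estimates, with \<open>m = 1\<close> and
  \<open>m = 2\<close>.\<close>

lemma abs_diff_le_of_deriv_bound:
  fixes h h' :: "real \<Rightarrow> real"
  assumes deriv: "\<And>t. 0 \<le> t \<Longrightarrow> t \<le> 1 \<Longrightarrow> (h has_real_derivative h' t) (at t)"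
    and bound: "\<And>t. 0 \<le> t \<Longrightarrow> t \<le> 1 \<Longrightarrow> \<bar>h' t\<bar> \<le> c * t ^ m"
  shows "\<bar>h 1 - h 0\<bar> \<le> c / (real m + 1)"
proof -
  have pw: "((\<lambda>t. c / (real m + 1) * t ^ Suc m) has_real_derivative c * t ^ m) (at t)" for t
  proof -
    have "c / (real m + 1) * (real (Suc m) * t ^ (Suc m - Suc 0)) = c * t ^ m"
      by (simp add: add.commute)
    then show ?thesis using DERIV_cmult[OF DERIV_pow[of "Suc m" t], of "c / (real m + 1)"] by simp
  qed
  have "c / (real m + 1) * 0 ^ Suc m - h 0 \<le> c / (real m + 1) * 1 ^ Suc m - h 1"
  proof (rule DERIV_nonneg_imp_nondecreasing[of 0 1 "\<lambda>t. c / (real m + 1) * t ^ Suc m - h t"])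
    fix t :: real assume t: "0 \<le> t" "t \<le> 1"
    show "\<exists>y. ((\<lambda>t. c / (real m + 1) * t ^ Suc m - h t) has_real_derivative y) (at t) \<and> 0 \<le> y"
      using DERIV_diff[OF pw deriv[OF t]] bound[OF t] by (intro exI[of _ "c * t ^ m - h' t"]) auto
  qed simp
  moreover have "c / (real m + 1) * 0 ^ Suc m + h 0 \<le> c / (real m + 1) * 1 ^ Suc m + h 1"
  proof (rule DERIV_nonneg_imp_nondecreasing[of 0 1 "\<lambda>t. c / (real m + 1) * t ^ Suc m + h t"])
    fix t :: real assume t: "0 \<le> t" "t \<le> 1"
    show "\<exists>y. ((\<lambda>t. c / (real m + 1) * t ^ Suc m + h t) has_real_derivative y) (at t) \<and> 0 \<le> y"
      using DERIV_add[OF pw deriv[OF t]] bound[OF t] by (intro exI[of _ "c * t ^ m + h' t"]) auto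
  qed simp
  ultimately show ?thesis by (simp add: abs_le_iff)
qed

context
  fixes n :: nat and f :: "real vec \<Rightarrow> real" and L :: real
  assumes diff: "twice_differentiable n f" and lip: "lipschitz_hessian n L f" and L: "L > 0"
begin

abbreviation (input) "G \<equiv> gradient n f"
abbreviation (input) "H \<equiv> hessian n f"

lemma has_gradient_G: "x \<in> carrier_vec n \<Longrightarrow> has_gradient n f (G x) x"
  using diff gradient_eq[of n f _ x] by (auto simp: twice_differentiable_def)

lemma G_carrier [simp]: "x \<in> carrier_vec n \<Longrightarrow> G x \<in> carrier_vec n"
  by (rule has_gradientD[OF has_gradient_G])

lemma has_jacobian_H: "x \<in> carrier_vec n \<Longrightarrow> has_jacobian n G (H x) x"
proof -
  assume x: "x \<in> carrier_vec n"
  obtain A where A: "has_jacobian n G A x" using diff x unfolding twice_differentiable_def by blast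
  have "H x = A" unfolding hessian_def
    by (rule the_equality, rule A, rule has_jacobian_unique[OF _ A x G_carrier])
  then show ?thesis using A by simp
qed

lemma H_carrier [simp]: "x \<in> carrier_vec n \<Longrightarrow> H x \<in> carrier_mat n n"
  using has_jacobian_H[of x] by (simp add: has_jacobian_def)

lemma H_dim [simp]: "x \<in> carrier_vec n \<Longrightarrow> dim_row (H x) = n" "x \<in> carrier_vec n \<Longrightarrow> dim_col (H x) = n"
  using carrier_matD[OF H_carrier] by blast+

lemma H_mult_carrier [simp]:
  "x \<in> carrier_vec n \<Longrightarrow> v \<in> carrier_vec n \<Longrightarrow> H x *\<^sub>v v \<in> carrier_vec n"
  using H_carrier by (rule mult_mat_vec_carrier)

lemma H_diff_bound:
  assumes "x \<in> carrier_vec n" "y \<in> carrier_vec n" "v \<in> carrier_vec n"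
  shows "vec_norm (H y *\<^sub>v v - H x *\<^sub>v v) \<le> L * vec_norm (y - x) * vec_norm v"
proof -
  have "H y *\<^sub>v v - H x *\<^sub>v v = (H y - H x) *\<^sub>v v"
    using assms minus_mult_distrib_mat_vec[OF H_carrier H_carrier] by metis
  also have "vec_norm \<dots> \<le> spectral_norm (H y - H x) * vec_norm v"
    using assms by (intro spectral_norm_bound) simp
  also have "\<dots> \<le> L * vec_norm (y - x) * vec_norm v"
    using lip[unfolded lipschitz_hessian_def, rule_format, OF assms(2,1)]
    by (rule mult_right_mono) simp
  finally show ?thesis .
qed

text \<open>The remainder \<open>w\<close> is tested against itself: \<open>h\<close> has increment
  \<open>w \<bullet> w\<close>, while the Lipschitz condition bounds \<open>h'\<close> by a multiple
  of \<open>vec_norm w\<close>, so one factor cancels.\<close>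

lemma gradient_taylor:
  assumes x: "x \<in> carrier_vec n" and d: "d \<in> carrier_vec n"
  shows "vec_norm (G (x + d) - G x - H x *\<^sub>v d) \<le> L / 2 * (vec_norm d)\<^sup>2"
proof -
  define w where "w = G (x + d) - G x - H x *\<^sub>v d"
  have w: "w \<in> carrier_vec n" using x d by (simp add: w_def)
  have xt: "x + t \<cdot>\<^sub>v d \<in> carrier_vec n" for t using x d by simp
  define h where "h t = w \<bullet> G (x + t \<cdot>\<^sub>v d) - t * (w \<bullet> (H x *\<^sub>v d))" for t
  define h' where "h' t = w \<bullet> (H (x + t \<cdot>\<^sub>v d) *\<^sub>v d) - w \<bullet> (H x *\<^sub>v d)" for t
  have "(h has_real_derivative h' t) (at t)" for t
  proof -
    have "((\<lambda>s. w \<bullet> G (x + s \<cdot>\<^sub>v d)) has_real_derivative ((H (x + t \<cdot>\<^sub>v d))\<^sup>T *\<^sub>v w) \<bullet> d) (at t)"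
      by (rule has_gradient_directional_derivative
          [OF has_jacobian_component[OF has_jacobian_H[OF xt] xt w G_carrier] x d])
    then show ?thesis
      unfolding h_def h'_def using transpose_vec_mult_scalar[OF H_carrier[OF xt] d w]
      by (auto intro!: derivative_eq_intros)
  qed
  moreover have "\<bar>h' t\<bar> \<le> (vec_norm w * L * (vec_norm d)\<^sup>2) * t ^ 1" if "0 \<le> t" for t
  proof -
    have "h' t = w \<bullet> (H (x + t \<cdot>\<^sub>v d) *\<^sub>v d - H x *\<^sub>v d)"
      using w x d xt by (simp add: h'_def scalar_prod_minus_distrib[of _ n])
    also have "\<bar>\<dots>\<bar> \<le> vec_norm w * vec_norm (H (x + t \<cdot>\<^sub>v d) *\<^sub>v d - H x *\<^sub>v d)"
      by (rule scalar_prod_abs_le[OF w]) (use x d xt in simp)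
    also have "\<dots> \<le> vec_norm w * (L * vec_norm (x + t \<cdot>\<^sub>v d - x) * vec_norm d)"
      by (intro mult_left_mono H_diff_bound x xt d) simp
    also have "x + t \<cdot>\<^sub>v d - x = t \<cdot>\<^sub>v d" using x d by (intro eq_vecI) auto
    finally show ?thesis using that by (simp add: power2_eq_square mult_ac)
  qed
  ultimately have "\<bar>h 1 - h 0\<bar> \<le> vec_norm w * L * (vec_norm d)\<^sup>2 / (real 1 + 1)"
    by (intro abs_diff_le_of_deriv_bound[of h h' _ 1]) auto
  moreover have "h 1 - h 0 = w \<bullet> w"
  proof -
    have "x + 1 \<cdot>\<^sub>v d = x + d" "x + 0 \<cdot>\<^sub>v d = x" using x d by auto
    then show ?thesis
      using w x d by (simp add: h_def w_def scalar_prod_minus_distrib[of _ n])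
  qed
  ultimately have "vec_norm w * vec_norm w \<le> vec_norm w * (L / 2 * (vec_norm d)\<^sup>2)"
    by (simp add: power2_vec_norm[symmetric] power2_eq_square)
  then show ?thesis
    using vec_norm_nonneg[of w] L unfolding w_def[symmetric]
    by (cases "vec_norm w = 0") (auto simp: mult_le_cancel_left)
qed

text \<open>The derivative of the remainder along the segment is \<open>d\<close> paired with the
  gradient remainder for the step \<open>t \<cdot>\<^sub>v d\<close>, hence of order
  \<open>t\<^sup>2\<close>; the factor 1/6 is 1/2 times 1/3.\<close>

lemma function_taylor:
  assumes x: "x \<in> carrier_vec n" and d: "d \<in> carrier_vec n"
  shows "\<bar>f (x + d) - f x - G x \<bullet> d - 1 / 2 * (d \<bullet> (H x *\<^sub>v d))\<bar> \<le> L / 6 * (vec_norm d) ^ 3"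
proof -
  have xt: "x + t \<cdot>\<^sub>v d \<in> carrier_vec n" for t using x d by simp
  define h where "h t = f (x + t \<cdot>\<^sub>v d) - t * (G x \<bullet> d) - t\<^sup>2 / 2 * (d \<bullet> (H x *\<^sub>v d))" for t
  define h' where "h' t = G (x + t \<cdot>\<^sub>v d) \<bullet> d - G x \<bullet> d - t * (d \<bullet> (H x *\<^sub>v d))" for t
  have "(h has_real_derivative h' t) (at t)" for t
  proof -
    have "((\<lambda>s. f (x + s \<cdot>\<^sub>v d)) has_real_derivative G (x + t \<cdot>\<^sub>v d) \<bullet> d) (at t)"
      by (rule has_gradient_directional_derivative[OF has_gradient_G[OF xt] x d])
    then show ?thesis
      unfolding h_def h'_def by (auto intro!: derivative_eq_intros)
  qed
  moreover have "\<bar>h' t\<bar> \<le> (L / 2 * vec_norm d ^ 3) * t ^ 2" if "0 \<le> t" for t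
  proof -
    have "h' t = d \<bullet> (G (x + t \<cdot>\<^sub>v d) - G x - H x *\<^sub>v (t \<cdot>\<^sub>v d))"
      using x d xt mult_mat_vec[OF H_carrier[OF x] d, of t]
      by (simp add: h'_def scalar_prod_minus_distrib[of _ n] comm_scalar_prod[of d n "G _"])
    also have "\<bar>\<dots>\<bar> \<le> vec_norm d * vec_norm (G (x + t \<cdot>\<^sub>v d) - G x - H x *\<^sub>v (t \<cdot>\<^sub>v d))"
      by (rule scalar_prod_abs_le[OF d]) (use x d xt in simp)
    also have "\<dots> \<le> vec_norm d * (L / 2 * (vec_norm (t \<cdot>\<^sub>v d))\<^sup>2)"
      by (intro mult_left_mono gradient_taylor x) (use d in auto)
    finally show ?thesis by (simp add: power2_eq_square power3_eq_cube mult_ac)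
  qed
  ultimately have "\<bar>h 1 - h 0\<bar> \<le> L / 2 * vec_norm d ^ 3 / (real 2 + 1)"
    by (intro abs_diff_le_of_deriv_bound[of h h' _ 2]) auto
  moreover have "x + 1 \<cdot>\<^sub>v d = x + d" "x + 0 \<cdot>\<^sub>v d = x" using x d by auto
  ultimately show ?thesis
    using x d by (simp add: h_def algebra_simps)
qed

text \<open>
  The second difference of \<open>f\<close> along \<open>tu\<close>, \<open>tv\<close> is symmetric in \<open>u\<close> and \<open>v\<close>, and equals
  \<open>t\<^sup>2 (v \<bullet> H u)\<close> up to an error of order \<open>t\<^sup>3\<close>.
\<close>

lemma hessian_symmetric:
  assumes x: "x \<in> carrier_vec n" and u: "u \<in> carrier_vec n" and v: "v \<in> carrier_vec n"
  shows "v \<bullet> (H x *\<^sub>v u) = u \<bullet> (H x *\<^sub>v v)"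
proof -
  \<comment> \<open>\<open>E\<close> collects two cubic remainders of
    \<open>function_taylor\<close>, the remainder of \<open>gradient_taylor\<close>, and the change
    of the Hessian between \<open>x\<close> and \<open>x + u\<close>. It is homogeneous of degree
    3.\<close>
  define E where "E a b = L * (b ^ 3 / 3 + a\<^sup>2 * b / 2 + a * b\<^sup>2 / 2)" for a b :: real
  have second_difference: "\<bar>f (x + u + v) - f (x + u) - f (x + v) + f x - v \<bullet> (H x *\<^sub>v u)\<bar>
      \<le> E (vec_norm u) (vec_norm v)" if u: "u \<in> carrier_vec n" and v: "v \<in> carrier_vec n" for u v
  proof -
    have xu: "x + u \<in> carrier_vec n" using x u by simp
    have 1: "\<bar>f (x + u + v) - f (x + u) - G (x + u) \<bullet> v - 1 / 2 * (v \<bullet> (H (x + u) *\<^sub>v v))\<bar>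
        \<le> L / 6 * vec_norm v ^ 3"
      by (rule function_taylor[OF xu v])
    have 2: "\<bar>f (x + v) - f x - G x \<bullet> v - 1 / 2 * (v \<bullet> (H x *\<^sub>v v))\<bar> \<le> L / 6 * vec_norm v ^ 3"
      by (rule function_taylor[OF x v])
    have "G (x + u) \<bullet> v - G x \<bullet> v - v \<bullet> (H x *\<^sub>v u) = v \<bullet> (G (x + u) - G x - H x *\<^sub>v u)"
      using x u v xu by (simp add: scalar_prod_minus_distrib[of _ n] comm_scalar_prod[of v n "G _"])
    also have "\<bar>\<dots>\<bar> \<le> vec_norm v * vec_norm (G (x + u) - G x - H x *\<^sub>v u)"
      by (rule scalar_prod_abs_le[OF v]) (use x u xu in simp)
    also have "\<dots> \<le> vec_norm v * (L / 2 * (vec_norm u)\<^sup>2)"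
      by (intro mult_left_mono gradient_taylor x u) simp
    finally have 3: "\<bar>G (x + u) \<bullet> v - G x \<bullet> v - v \<bullet> (H x *\<^sub>v u)\<bar> \<le> vec_norm v * (L / 2 * (vec_norm u)\<^sup>2)" .
    have "v \<bullet> (H (x + u) *\<^sub>v v) - v \<bullet> (H x *\<^sub>v v) = v \<bullet> (H (x + u) *\<^sub>v v - H x *\<^sub>v v)"
      using x v xu by (simp add: scalar_prod_minus_distrib[of _ n])
    also have "\<bar>\<dots>\<bar> \<le> vec_norm v * vec_norm (H (x + u) *\<^sub>v v - H x *\<^sub>v v)"
      by (rule scalar_prod_abs_le[OF v]) (use x v xu in simp)
    also have "\<dots> \<le> vec_norm v * (L * vec_norm (x + u - x) * vec_norm v)"
      by (intro mult_left_mono H_diff_bound x xu v) simp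
    also have "x + u - x = u" using x u by (intro eq_vecI) auto
    finally have 4: "\<bar>v \<bullet> (H (x + u) *\<^sub>v v) - v \<bullet> (H x *\<^sub>v v)\<bar> \<le> vec_norm v * (L * vec_norm u * vec_norm v)" .
    have "E (vec_norm u) (vec_norm v) = L / 6 * vec_norm v ^ 3 + L / 6 * vec_norm v ^ 3
      + vec_norm v * (L / 2 * (vec_norm u)\<^sup>2) + 1 / 2 * (vec_norm v * (L * vec_norm u * vec_norm v))"
      by (simp add: E_def power2_eq_square power3_eq_cube algebra_simps)
    with 1 2 3 4 show ?thesis by linarith
  qed
  define D where "D = \<bar>v \<bullet> (H x *\<^sub>v u) - u \<bullet> (H x *\<^sub>v v)\<bar>"
  define B where "B = E (vec_norm u) (vec_norm v) + E (vec_norm v) (vec_norm u)"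
  have B: "B \<ge> 0" using L by (simp add: B_def E_def)
  have small: "D \<le> t * B" if t: "t > 0" for t
  proof -
    let ?u = "t \<cdot>\<^sub>v u" and ?v = "t \<cdot>\<^sub>v v"
    have c: "?u \<in> carrier_vec n" "?v \<in> carrier_vec n" using u v by auto
    have "x + ?u + ?v = x + ?v + ?u" using x u v by (intro eq_vecI) auto
    then have "\<bar>?v \<bullet> (H x *\<^sub>v ?u) - ?u \<bullet> (H x *\<^sub>v ?v)\<bar>
      \<le> E (vec_norm ?u) (vec_norm ?v) + E (vec_norm ?v) (vec_norm ?u)"
      using second_difference[OF c] second_difference[OF c(2) c(1)] by (simp add: abs_le_iff)
    also have "\<dots> = t ^ 3 * B"
      using t by (simp add: E_def B_def power2_eq_square power3_eq_cube algebra_simps)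
    also have "?v \<bullet> (H x *\<^sub>v ?u) - ?u \<bullet> (H x *\<^sub>v ?v) = t\<^sup>2 * (v \<bullet> (H x *\<^sub>v u) - u \<bullet> (H x *\<^sub>v v))"
      using x u v mult_mat_vec[OF H_carrier[OF x] u, of t] mult_mat_vec[OF H_carrier[OF x] v, of t]
      by (simp add: power2_eq_square algebra_simps)
    finally have "t\<^sup>2 * D \<le> t\<^sup>2 * (t * B)"
      by (simp add: D_def abs_mult power2_eq_square power3_eq_cube mult_ac)
    then show ?thesis using t by simp
  qed
  have "D \<le> 0"
  proof (rule ccontr)
    assume "\<not> D \<le> 0"
    then have "D > 0" by simp
    \<comment> \<open>Here \<open>t = D / (2 * (B + 1))\<close>, which is positive even for
      \<open>B = 0\<close> and makes \<open>t * B\<close> smaller than \<open>D\<close>.\<close>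
    then have "D \<le> D / (2 * (B + 1)) * B" using B by (intro small) simp
    also have "\<dots> < D" using \<open>D > 0\<close> B by (simp add: field_simps add_nonneg_pos)
    finally show False by simp
  qed
  then show ?thesis by (simp add: D_def)
qed

section \<open>The model gradient and lower bounds on the step length\<close>

text \<open>The quadratic part contributes half the sum of the Hessian and its transpose, applied to
  \<open>d\<close>; symmetry turns this into \<open>H x *\<^sub>v d\<close>, and the remainder is
  exactly half of \<open>h \<bullet> (H x *\<^sub>v h)\<close>.\<close>

lemma gradient_quad_model:
  assumes x: "x \<in> carrier_vec n" and d: "d \<in> carrier_vec n"
  shows "gradient n (quad_model n f x) d = G x + H x *\<^sub>v d"
proof (rule gradient_eq[OF _ d], unfold has_gradient_def, intro conjI allI impI)
  show "G x + H x *\<^sub>v d \<in> carrier_vec n" using x d by simp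
  fix e :: real assume e: "0 < e"
  obtain c where c: "\<And>v. v \<in> carrier_vec n \<Longrightarrow> vec_norm (H x *\<^sub>v v) \<le> c * vec_norm v"
    using mult_mat_vec_bounded[of "H x"] x by auto
  define N where "N = \<bar>c\<bar> + 1"
  show "\<exists>s>0. \<forall>h\<in>carrier_vec n. vec_norm h < s \<longrightarrow>
    \<bar>quad_model n f x (d + h) - quad_model n f x d - (G x + H x *\<^sub>v d) \<bullet> h\<bar> \<le> e * vec_norm h"
  proof (intro exI[of _ "e / N"] conjI ballI impI)
    show "0 < e / N" using e by (simp add: N_def add_nonneg_pos)
    fix h assume h: "h \<in> carrier_vec n" "vec_norm h < e / N"
    have "quad_model n f x (d + h) - quad_model n f x d - (G x + H x *\<^sub>v d) \<bullet> h
        = 1 / 2 * (h \<bullet> (H x *\<^sub>v h))"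
      using x d h mult_add_distrib_mat_vec[OF H_carrier[OF x] d h(1)] hessian_symmetric[OF x d h(1)]
      by (simp add: quad_model_def scalar_prod_add_distrib[of _ n] add_scalar_prod_distrib[of _ n]
          comm_scalar_prod[of "H x *\<^sub>v d" n h] algebra_simps)
    also have "\<bar>\<dots>\<bar> \<le> 1 / 2 * (vec_norm h * vec_norm (H x *\<^sub>v h))"
      using scalar_prod_abs_le[OF h(1), of "H x *\<^sub>v h"] x h by simp
    also have "\<dots> \<le> vec_norm h * (N * vec_norm h)"
    proof -
      have "vec_norm (H x *\<^sub>v h) \<le> c * vec_norm h" using c h by simp
      also have "\<dots> \<le> N * vec_norm h" by (intro mult_right_mono) (auto simp: N_def)
      finally have "vec_norm h * vec_norm (H x *\<^sub>v h) \<le> vec_norm h * (N * vec_norm h)"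
        by (rule mult_left_mono) simp
      moreover have "0 \<le> vec_norm h * vec_norm (H x *\<^sub>v h)" by simp
      ultimately show ?thesis by linarith
    qed
    also have "\<dots> \<le> vec_norm h * e"
    proof -
      have "N > 0" by (simp add: N_def add_nonneg_pos)
      then have "N * vec_norm h \<le> e" using h(2) by (simp add: field_simps)
      then show ?thesis by (rule mult_left_mono) simp
    qed
    finally show "\<bar>quad_model n f x (d + h) - quad_model n f x d - (G x + H x *\<^sub>v d) \<bullet> h\<bar>
      \<le> e * vec_norm h" by (simp add: mult.commute)
  qed
qed

text \<open>The new gradient is the Taylor error plus the residual of the inexact subproblem minus
  \<open>\<delta> \<cdot>\<^sub>v d\<close>; the triangle inequality does the rest.\<close>

lemma CAT_gradient_bound:
  assumes x: "x \<in> carrier_vec n" and d: "d \<in> carrier_vec n" and \<delta>: "\<delta> \<ge> 0"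
    and inexact: "vec_norm (gradient n (quad_model n f x) d + \<delta> \<cdot>\<^sub>v d) \<le> \<gamma> * vec_norm (G (x + d))"
  shows "vec_norm (G (x + d)) \<le> \<gamma> * vec_norm (G (x + d)) + \<delta> * vec_norm d + L / 2 * (vec_norm d)\<^sup>2"
proof -
  let ?e = "G (x + d) - G x - H x *\<^sub>v d" and ?m = "G x + H x *\<^sub>v d + \<delta> \<cdot>\<^sub>v d"
  have c: "G (x + d) \<in> carrier_vec n" "G x \<in> carrier_vec n" "H x *\<^sub>v d \<in> carrier_vec n"
    using x d by simp_all
  have "a = a - b - h + (b + h + m - m)"
    if "a \<in> carrier_vec n" "b \<in> carrier_vec n" "h \<in> carrier_vec n" "m \<in> carrier_vec n"
    for a b h m :: "real vec"
    using that by (intro eq_vecI) auto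
  from this[OF c, of "\<delta> \<cdot>\<^sub>v d"] have "G (x + d) = ?e + (?m - \<delta> \<cdot>\<^sub>v d)"
    using d by simp
  then have "vec_norm (G (x + d)) \<le> vec_norm ?e + vec_norm (?m - \<delta> \<cdot>\<^sub>v d)"
    using vec_norm_add[of ?e n "?m - \<delta> \<cdot>\<^sub>v d"] c d by simp
  also have "vec_norm (?m - \<delta> \<cdot>\<^sub>v d) \<le> vec_norm ?m + \<delta> * vec_norm d"
    using vec_norm_diff[of ?m n "\<delta> \<cdot>\<^sub>v d"] c d \<delta> by simp
  finally show ?thesis
    using gradient_taylor[OF x d] inexact gradient_quad_model[OF x d] by simp
qed

text \<open>A failed ratio test means that the model decrease, at least of order
  \<open>\<delta> * D\<^sup>2\<close>, is dominated by the cubic Taylor error and the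
  \<open>\<theta>\<close> term. This bounds \<open>\<delta> * D\<close>, which is then eliminated
  from \<open>CAT_gradient_bound\<close>. The coefficient on the left is the slack in the parameter
  condition of the theorem.\<close>

lemma CAT_short_step:
  assumes x: "x \<in> carrier_vec n" and d: "d \<in> carrier_vec n" and \<delta>: "\<delta> \<ge> 0"
    and inexact: "vec_norm (gradient n (quad_model n f x) d + \<delta> \<cdot>\<^sub>v d) \<le> \<gamma>1 * vec_norm (G (x + d))"
    and model: "quad_model n f x d \<le> - \<gamma>3 * (\<delta> / 2) * (vec_norm d)\<^sup>2"
    and par: "0 < \<theta>" "0 < \<beta>" "\<beta> < 1" "0 < \<gamma>3"
    and pos: "0 < vec_norm (G (x + d))" "0 < vec_norm d"
    and short: "\<delta> = 0 \<or> rho_hat n f \<theta> x d < \<beta>"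
  shows "(1 - (\<beta> * \<theta> / (\<gamma>3 * (1 - \<beta>)) + \<gamma>1)) * vec_norm (G (x + d))
    \<le> (1 / 2 + 1 / (3 * \<gamma>3 * (1 - \<beta>))) * L * (vec_norm d)\<^sup>2"
proof -
  define g where "g = vec_norm (G (x + d))"
  define D where "D = vec_norm d"
  define M where "M = - quad_model n f x d"
  define p where "p = \<gamma>3 * (1 - \<beta>)"
  have p: "p > 0" using par by (simp add: p_def)
  have gD: "g > 0" "D > 0" using pos by (simp_all add: g_def D_def)
  have g: "g \<le> \<gamma>1 * g + \<delta> * D + L / 2 * D\<^sup>2"
    using CAT_gradient_bound[OF x d \<delta> inexact] by (simp add: g_def D_def)
  have M: "M \<ge> \<gamma>3 * (\<delta> / 2) * D\<^sup>2" using model by (simp add: M_def D_def)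
  have "p * (\<delta> * D) \<le> L / 3 * D\<^sup>2 + \<beta> * \<theta> * g"
    using short
  proof
    assume "\<delta> = 0"
    then show ?thesis using L par gD by simp
  next
    assume rho: "rho_hat n f \<theta> x d < \<beta>"
    have "0 \<le> \<gamma>3 * (\<delta> / 2) * D\<^sup>2" using par \<delta> by simp
    then have "0 \<le> M" using M by linarith
    \<comment> \<open>Positivity allows clearing the denominator of \<open>rho_hat\<close> and
      excludes the convention for division by zero.\<close>
    then have den: "M + \<theta> / 2 * g * D > 0" using par gD by (intro add_nonneg_pos) auto
    have "f x - f (x + d) < \<beta> * (M + \<theta> / 2 * g * D)"
      using rho den by (simp add: rho_hat_def M_def g_def D_def divide_less_eq)
    moreover have "M - L / 6 * D ^ 3 \<le> f x - f (x + d)"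
      using function_taylor[OF x d] unfolding M_def D_def quad_model_def by linarith
    ultimately have "(1 - \<beta>) * M \<le> L / 6 * D ^ 3 + \<beta> * (\<theta> / 2 * g * D)"
      by (simp add: algebra_simps)
    moreover have "(1 - \<beta>) * (\<gamma>3 * (\<delta> / 2) * D\<^sup>2) \<le> (1 - \<beta>) * M"
      using M par by (intro mult_left_mono) auto
    ultimately have "(1 - \<beta>) * (\<gamma>3 * (\<delta> / 2) * D\<^sup>2) \<le> L / 6 * D ^ 3 + \<beta> * (\<theta> / 2 * g * D)"
      by simp
    then have "D / 2 * (p * (\<delta> * D)) \<le> D / 2 * (L / 3 * D\<^sup>2 + \<beta> * \<theta> * g)"
      by (simp add: p_def power2_eq_square power3_eq_cube algebra_simps)
    then show ?thesis using gD by simp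
  qed
  then have "\<delta> * D \<le> (L / 3 * D\<^sup>2 + \<beta> * \<theta> * g) / p"
    using p by (simp add: pos_le_divide_eq mult.commute)
  then have "g \<le> \<gamma>1 * g + (L / 3 * D\<^sup>2 + \<beta> * \<theta> * g) / p + L / 2 * D\<^sup>2"
    using g by simp
  then have "(1 - (\<beta> * \<theta> / p + \<gamma>1)) * g \<le> (1 / 2 + 1 / (3 * p)) * L * D\<^sup>2"
    by (simp add: algebra_simps add_divide_distrib)
  then show ?thesis by (simp add: p_def g_def D_def mult.assoc)
qed

end

section \<open>Counting iterations by a potential on real sequences\<close>

text \<open>Only scalars remain: \<open>F\<close> stands for objective values, \<open>D\<close> for
  step lengths, \<open>c\<close> for the decrease per unit of length. The potential
  \<open>P * F k + \<phi> (u k)\<close> drops by at least 1 per iteration, so its initial excess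
  over \<open>P * Fmin\<close> bounds the count.\<close>

lemma CAT_count_le:
  fixes F D r :: "nat \<Rightarrow> real" and a c \<gamma> \<omega> Fmin :: real
  assumes a: "a > 0" and c: "c > 0" and \<omega>: "\<omega> > 1" and \<gamma>: "1 / \<omega> < \<gamma>" "\<gamma> \<le> 1"
    and D: "\<And>k. 1 \<le> k \<Longrightarrow> k \<le> K \<Longrightarrow> 0 < D k \<and> D k \<le> r k"
    and step: "\<And>k. 1 \<le> k \<Longrightarrow> k \<le> K \<Longrightarrow>
      F (Suc k) \<le> F k - c * D k \<and> r (Suc k) = \<omega> * D k \<and> (\<gamma> * r k \<le> D k \<or> a \<le> D k) \<or>
      F (Suc k) \<le> F k \<and> r (Suc k) = D k / \<omega> \<and> a \<le> D k"
    and Fmin: "\<And>k. 1 \<le> k \<Longrightarrow> Fmin \<le> F k"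
    and r1: "r 1 > 0"
  shows "real K \<le> 2 * \<omega> / (c * \<gamma> * a) * (F 1 - Fmin) + 2
     + max 0 (ln (a / (\<omega> * r 1))) / ln (\<omega> * \<gamma>) + max 0 (ln (\<omega> * r 1 / a)) / ln \<omega>"
proof -
  define q where "q = ln (\<omega> * \<gamma>)"
  define l where "l = ln \<omega>"
  \<comment> \<open>With this \<open>P\<close>, a successful step of length at least
    \<open>\<gamma> * (a / \<omega>)\<close> lowers \<open>P * F\<close> by 2: one unit for the
    iteration, one for the possible rise of \<open>\<phi>\<close>.\<close>
  define P where "P = 2 * \<omega> / (c * \<gamma> * a)"
  \<comment> \<open>For a positive radius, \<open>u k\<close> is nonnegative exactly when
    \<open>r k\<close> has reached \<open>a / \<omega>\<close>; the factors \<open>\<omega>\<close>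
    and \<open>\<omega> * \<gamma>\<close> become shifts by \<open>l\<close> and
    \<open>q\<close>.\<close>
  define u where "u k = ln (\<omega> * r k / a)" for k
  \<comment> \<open>The offset 2 pays for the one step in which \<open>u\<close> changes sign: then \<open>\<phi>\<close> falls from above 2 to at most 1.\<close>
  define \<phi> where "\<phi> s = (if 0 \<le> s then s / l else 2 - s / q)" for s
  have "0 < 1 / \<omega>" using \<omega> by simp
  then have g0: "\<gamma> > 0" using \<gamma> by linarith
  have "\<omega> * \<gamma> > 1" using \<gamma> \<omega> by (simp add: field_simps)
  then have q: "q > 0" by (simp add: q_def)
  have l: "l > 0" using \<omega> by (simp add: l_def)
  have P: "P > 0" using \<omega> c g0 a by (simp add: P_def)
  have rpos: "r k > 0" if "1 \<le> k" "k \<le> Suc K" for k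
  proof (cases k)
    case (Suc j)
    show ?thesis
    proof (cases "j = 0")
      case True then show ?thesis using r1 Suc by simp
    next
      case False
      then have "1 \<le> j" "j \<le> K" using that Suc by auto
      then have "D j > 0" "r (Suc j) = \<omega> * D j \<or> r (Suc j) = D j / \<omega>"
        using D step by blast+
      then show ?thesis using \<omega> Suc by auto
    qed
  qed (use that in simp)
  have phi0: "\<phi> s \<ge> 0" for s
    using l q by (auto simp: \<phi>_def divide_nonpos_pos intro: order_trans[of _ 0])
  have one: "P * F (Suc k) + \<phi> (u (Suc k)) + 1 \<le> P * F k + \<phi> (u k)" if k: "1 \<le> k" "k \<le> K" for k
  proof -
    have Dk: "0 < D k" "D k \<le> r k" and rk: "r k > 0" "r (Suc k) > 0"
      using D rpos k by auto
    show ?thesis using step[OF k]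
    proof (elim disjE conjE)
      assume *: "F (Suc k) \<le> F k" "r (Suc k) = D k / \<omega>" "a \<le> D k"
      have u': "u (Suc k) = ln (D k / a)" using \<omega> by (simp add: u_def *)
      \<comment> \<open>A failed step is long, so the new radius is still at least
        \<open>a / \<omega>\<close>; since \<open>D k \<le> r k\<close>, it shrinks by at least
        \<open>\<omega>\<close>, which lowers \<open>\<phi>\<close> by at least 1.\<close>
      have "0 \<le> u (Suc k)" unfolding u' using * a by simp
      moreover have "u (Suc k) + l \<le> u k"
      proof -
        have "u (Suc k) + l = ln (\<omega> * D k / a)"
          using \<omega> a Dk unfolding u' l_def by (simp add: ln_mult ln_div)
        also have "\<dots> \<le> u k"
          unfolding u_def using \<omega> a Dk by (simp add: divide_right_mono)
        finally show ?thesis .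
      qed
      ultimately have "\<phi> (u (Suc k)) + 1 \<le> \<phi> (u k)"
        using l divide_right_mono[of "u (Suc k) + l" "u k" l]
        by (simp add: \<phi>_def add_divide_distrib)
      moreover have "P * F (Suc k) \<le> P * F k" using * P by simp
      ultimately show ?thesis by simp
    next
      assume S: "F (Suc k) \<le> F k - c * D k" "r (Suc k) = \<omega> * D k"
      have ul: "u (Suc k) \<le> u k + l"
      proof -
        have "u k + l = ln (\<omega> * (\<omega> * r k) / a)"
          using \<omega> a rk by (simp add: u_def l_def ln_mult ln_div)
        also have "\<dots> \<ge> u (Suc k)"
          unfolding u_def S using \<omega> a Dk by (simp add: divide_right_mono)
        finally show ?thesis .
      qed
      have upos: "0 \<le> u (Suc k)" if "a \<le> \<omega> * (\<omega> * D k)"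
        unfolding u_def S using that a by simp
      have PF: "P * F (Suc k) \<le> P * F k - P * (c * D k)"
        using mult_left_mono[OF S(1), of P] P by (simp add: algebra_simps)
      have PD: "0 \<le> P * (c * D k)" using P c Dk by simp
      have ww: "D k \<le> \<omega> * (\<omega> * D k)"
      proof -
        have "1 * (1 * D k) \<le> \<omega> * (\<omega> * D k)" using \<omega> Dk by (intro mult_mono) auto
        then show ?thesis by simp
      qed
      \<comment> \<open>For \<open>u k \<ge> 0\<close> the decrease of \<open>F\<close> pays. For
        \<open>u k < 0\<close> that decrease may be tiny and \<open>\<phi>\<close> pays, through
        growth of \<open>u\<close> by \<open>q\<close> or through the sign change.\<close>
      have main: ?thesis if qq: "0 \<le> u k \<Longrightarrow> \<gamma> * (a / \<omega>) \<le> D k"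
        and nn: "0 \<le> u k \<Longrightarrow> 0 \<le> u (Suc k)"
        and gq: "u k < 0 \<Longrightarrow> u k + q \<le> u (Suc k)"
      proof (cases "0 \<le> u k")
        case True
        have "2 = P * (c * (\<gamma> * (a / \<omega>)))"
          using c g0 a \<omega> by (simp add: P_def)
        also have "\<dots> \<le> P * (c * D k)"
          using qq[OF True] P c by (intro mult_left_mono) auto
        finally have "2 \<le> P * (c * D k)" .
        moreover have "\<phi> (u (Suc k)) \<le> \<phi> (u k) + 1"
          using True nn[OF True] ul l divide_right_mono[of "u (Suc k)" "u k + l" l]
          by (simp add: \<phi>_def add_divide_distrib)
        ultimately show ?thesis using PF by simp
      next
        case False
        have "\<phi> (u (Suc k)) + 1 \<le> \<phi> (u k)"
        proof (cases "0 \<le> u (Suc k)")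
          case T: True
          have "u (Suc k) \<le> l" using ul False by simp
          then have "\<phi> (u (Suc k)) \<le> 1" using T l by (simp add: \<phi>_def)
          moreover have "u k / q < 0" using False q by (simp add: divide_neg_pos)
          then have "\<phi> (u k) \<ge> 2" using False by (simp add: \<phi>_def)
          ultimately show ?thesis by simp
        next
          case F: False
          then show ?thesis
            using False gq q divide_right_mono[of "u k + q" "u (Suc k)" q]
            by (simp add: \<phi>_def add_divide_distrib)
        qed
        then show ?thesis using PF PD by simp
      qed
      {
        \<comment> \<open>The step uses at least the fraction \<open>\<gamma>\<close> of the radius,
          so the radius grows by a factor of at least \<open>\<omega> * \<gamma>\<close>.\<close>
        assume d: "\<gamma> * r k \<le> D k"
        have gq: "u k + q \<le> u (Suc k)"
        proof -
          have "u k + q = ln (\<omega> * (\<omega> * (\<gamma> * r k)) / a)"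
            using \<omega> a rk g0 by (simp add: u_def q_def ln_mult ln_div)
          also have "\<dots> \<le> u (Suc k)"
            unfolding u_def S using \<omega> a Dk rk g0 d by (simp add: divide_right_mono)
          finally show ?thesis .
        qed
        have "\<gamma> * (a / \<omega>) \<le> D k" if "0 \<le> u k"
        proof -
          have "a / \<omega> \<le> r k" using that a \<omega> rk by (simp add: u_def field_simps)
          then show ?thesis using d g0 by (meson mult_left_mono less_imp_le order_trans)
        qed
        then show ?thesis using main gq q by simp
      }
      {
        \<comment> \<open>A long successful step makes \<open>u (Suc k)\<close> nonnegative,
          whatever the sign of \<open>u k\<close>.\<close>
        assume d: "a \<le> D k"
        have up: "0 \<le> u (Suc k)" using upos d ww by simp
        have dd: "\<gamma> * (a / \<omega>) \<le> D k"
        proof -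
          have "\<gamma> * (a / \<omega>) \<le> 1 * (a / 1)"
            using \<gamma> g0 a \<omega> by (intro mult_mono frac_le) auto
          then show ?thesis using d by simp
        qed
        show ?thesis
        proof (cases "0 \<le> u k")
          case True
          then show ?thesis using main up dd by simp
        next
          case False
          have "u (Suc k) \<le> l" using ul False by simp
          then have "\<phi> (u (Suc k)) \<le> 1" using up l by (simp add: \<phi>_def)
          moreover have "u k / q < 0" using False q by (simp add: divide_neg_pos)
          then have "\<phi> (u k) \<ge> 2" using False by (simp add: \<phi>_def)
          ultimately show ?thesis using PF PD by simp
        qed
      }
    qed
  qed
  \<comment> \<open>The sequences start at 1, so \<open>k\<close> iterations lead to index
    \<open>Suc k\<close>, and the base case \<open>k = 0\<close> concerns index 1.\<close>
  have "P * F (Suc k) + \<phi> (u (Suc k)) + real k \<le> P * F 1 + \<phi> (u 1)" if "k \<le> K" for k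
    using that
  proof (induction k)
    case (Suc k)
    then show ?case using one[of "Suc k"] by simp
  qed simp
  from this[of K] have "real K \<le> P * F 1 - P * F (Suc K) + \<phi> (u 1)"
    using phi0[of "u (Suc K)"] by simp
  also have "\<dots> \<le> P * (F 1 - Fmin) + \<phi> (u 1)"
    using Fmin[of "Suc K"] P by (simp add: algebra_simps)
  also have "\<phi> (u 1) \<le> 2 + max 0 (- u 1) / q + max 0 (u 1) / l"
    using l q by (auto simp: \<phi>_def max_def)
  also have "- u 1 = ln (a / (\<omega> * r 1))"
    using a \<omega> r1 by (simp add: u_def ln_div ln_mult)
  finally show ?thesis
    by (simp add: P_def q_def l_def u_def add.assoc)
qed

section \<open>Absorbing the initial radius into the stated bound\<close>

text \<open>With \<open>X\<close> the leading term and \<open>T\<close> the logarithm of the target,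
  the two logarithms on the left are at most \<open>T + B\<close> and \<open>X + T + B\<close>. Here
  \<open>B\<close> accounts for \<open>\<omega>\<close> and for the factor \<open>sqrt c\<close>
  between \<open>a\<close> and \<open>sqrt (\<epsilon> / L)\<close>.\<close>

lemma CAT_bound_arith:
  fixes \<epsilon> L \<Delta> r c \<beta> \<theta> \<omega> \<gamma> :: real
  assumes pos: "\<epsilon> > 0" "L > 0" "\<Delta> > 0" "r > 0" "c > 0"
    and par: "\<beta> > 0" "\<theta> > 0" "\<omega> > 1" "\<gamma> > 0" "\<omega> * \<gamma> > 1"
    and a: "a = sqrt (\<epsilon> / (c * L))"
    and B: "B = \<bar>ln (\<omega> * sqrt c)\<bar>"
  shows "2 * \<omega> / (\<beta> * \<theta> * \<epsilon> / 2 * \<gamma> * a) * \<Delta> + 2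
     + max 0 (ln (a / (\<omega> * r))) / ln (\<omega> * \<gamma>) + max 0 (ln (\<omega> * r / a)) / ln \<omega>
   \<le> (4 * \<omega> * sqrt c / (\<beta> * \<theta> * \<gamma>) + 2 + (1 + B) / ln (\<omega> * \<gamma>) + (1 + B) / ln \<omega>)
     * (\<Delta> * L powr (1/2) / \<epsilon> powr (3/2)
        + ln (\<epsilon> powr (1/2) / (L powr (1/2) * r) + r * \<epsilon> / \<Delta> + 1) + 1)"
proof -
  define X where "X = \<Delta> * sqrt L / (\<epsilon> * sqrt \<epsilon>)"
  define Y where "Y = sqrt \<epsilon> / (sqrt L * r)"
  define Z where "Z = r * \<epsilon> / \<Delta>"
  define T where "T = ln (Y + Z + 1)"
  define p where "p = 4 * \<omega> * sqrt c / (\<beta> * \<theta> * \<gamma>)"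
  define q where "q = 1 / ln (\<omega> * \<gamma>)"
  define l where "l = 1 / ln \<omega>"
  have "\<epsilon> powr (3/2) = \<epsilon> powr 1 * \<epsilon> powr (1/2)"
    unfolding powr_add[symmetric] by simp
  then have powr: "\<epsilon> powr (3/2) = \<epsilon> * sqrt \<epsilon>" "\<epsilon> powr (1/2) = sqrt \<epsilon>" "L powr (1/2) = sqrt L"
    using pos by (simp_all add: powr_half_sqrt)
  have XYZ: "X > 0" "Y > 0" "Z > 0" using pos by (simp_all add: X_def Y_def Z_def)
  have T: "T \<ge> 0" "ln Y \<le> T" "ln Z \<le> T" using XYZ by (simp_all add: T_def)
  have plq: "p \<ge> 0" "q \<ge> 0" "l \<ge> 0" using par pos by (simp_all add: p_def q_def l_def)
  have B0: "B \<ge> 0" by (simp add: B)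
  have a': "a = sqrt \<epsilon> / (sqrt c * sqrt L)" by (simp add: a real_sqrt_divide real_sqrt_mult)
  have 1: "2 * \<omega> / (\<beta> * \<theta> * \<epsilon> / 2 * \<gamma> * a) * \<Delta> = p * X"
    using pos par by (simp add: a' p_def X_def field_simps)
  have sc: "\<omega> * sqrt c > 0" using par pos by simp
  have "a / (\<omega> * r) = Y / (\<omega> * sqrt c)"
    using pos par by (simp add: a' Y_def field_simps)
  then have "ln (a / (\<omega> * r)) = ln Y - ln (\<omega> * sqrt c)"
    using ln_divide_pos[OF XYZ(2) sc] by simp
  then have 2: "max 0 (ln (a / (\<omega> * r))) \<le> T + B"
    using T B0 B by linarith
  have "1 / Y = X * Z"
    using pos by (simp add: X_def Y_def Z_def field_simps)
  then have "\<omega> * r / a = (\<omega> * sqrt c) * (X * Z)"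
    using pos par by (simp add: a' X_def Z_def field_simps)
  then have "ln (\<omega> * r / a) = ln (\<omega> * sqrt c) + (ln X + ln Z)"
    using ln_mult_pos[OF sc mult_pos_pos[OF XYZ(1) XYZ(3)]] ln_mult_pos[OF XYZ(1) XYZ(3)] by simp
  moreover have "ln X \<le> X" using ln_le_minus_one[OF XYZ(1)] by simp
  ultimately have 3: "max 0 (ln (\<omega> * r / a)) \<le> X + T + B"
    using T B0 B XYZ by linarith
  \<comment> \<open>All quantities are nonnegative, so \<open>T + B\<close> and
    \<open>X + T + B\<close> are both at most \<open>(1 + B) * (X + T + 1)\<close>.\<close>
  have "p * X + 2 + (T + B) * q + (X + T + B) * l \<le> (p + 2 + (1 + B) * q + (1 + B) * l) * (X + T + 1)"
    using XYZ T B0 plq by (simp add: algebra_simps)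
  moreover have "max 0 (ln (a / (\<omega> * r))) * q \<le> (T + B) * q" "max 0 (ln (\<omega> * r / a)) * l \<le> (X + T + B) * l"
    using 2 3 plq by (simp_all add: mult_right_mono)
  ultimately have "p * X + 2 + max 0 (ln (a / (\<omega> * r))) * q + max 0 (ln (\<omega> * r / a)) * l
      \<le> (p + 2 + (1 + B) * q + (1 + B) * l) * (X + T + 1)"
    by linarith
  then show ?thesis
    unfolding 1 powr by (simp add: X_def[symmetric] Y_def[symmetric] Z_def[symmetric] T_def[symmetric]
        p_def[symmetric] q_def l_def)
qed

section \<open>Choice of the constant and transfer from runs to real sequences\<close>

theorem theorem1:
  fixes \<theta> \<beta> \<omega> \<gamma>1 \<gamma>2 \<gamma>3 :: real
  assumes "0 < \<theta>" "\<theta> < 1"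
    and "0 < \<beta>" "\<beta> < 1"
    and "1 < \<omega>"
    and "0 \<le> \<gamma>1" "\<gamma>1 < 1"
    and "1 / \<omega> < \<gamma>2" "\<gamma>2 \<le> 1"
    and "0 < \<gamma>3" "\<gamma>3 \<le> 1"
    and "\<beta> * \<theta> / (\<gamma>3 * (1 - \<beta>)) + \<gamma>1 < 1"
  shows "\<exists>C>0. \<forall>n\<ge>1. \<forall>(f :: real vec \<Rightarrow> real) (L :: real) x1 (r1 :: real) \<Delta>f x d \<delta> r.
    twice_differentiable n f \<longrightarrow>
    bdd_below (f ` carrier_vec n) \<longrightarrow>
    L > 0 \<longrightarrow>
    lipschitz_hessian n L f \<longrightarrow>
    x1 \<in> carrier_vec n \<longrightarrow>
    r1 > 0 \<longrightarrow>
    \<Delta>f = f x1 - (INF y\<in>carrier_vec n. f y) \<longrightarrow>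
    \<Delta>f > 0 \<longrightarrow>
    CAT_run n f \<theta> \<beta> \<omega> \<gamma>1 \<gamma>2 \<gamma>3 x1 r1 x d \<delta> r \<longrightarrow>
    (\<forall>\<epsilon>>0. \<exists>k\<ge>1.
      vec_norm (gradient n f (x k + d k)) \<le> \<epsilon> \<and>
      real k \<le> C * (\<Delta>f * L powr (1/2) / \<epsilon> powr (3/2)
        + ln (\<epsilon> powr (1/2) / (L powr (1/2) * r1) + r1 * \<epsilon> / \<Delta>f + 1) + 1))"
proof -
  \<comment> \<open>\<open>\<kappa>\<close> is the slack in the parameter condition, and
    \<open>c\<close> turns \<open>CAT_short_step\<close> into a bound of the gradient norm by
    \<open>c * L * (vec_norm (d k))\<^sup>2\<close>; hence the critical length \<open>a\<close>
    below.\<close>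
  define \<kappa> where "\<kappa> = 1 - (\<beta> * \<theta> / (\<gamma>3 * (1 - \<beta>)) + \<gamma>1)"
  define c where "c = (1 / 2 + 1 / (3 * \<gamma>3 * (1 - \<beta>))) / \<kappa>"
  define B where "B = \<bar>ln (\<omega> * sqrt c)\<bar>"
  define C where "C = 4 * \<omega> * sqrt c / (\<beta> * \<theta> * \<gamma>2) + 2 + (1 + B) / ln (\<omega> * \<gamma>2) + (1 + B) / ln \<omega>"
  have \<kappa>: "\<kappa> > 0" using assms(12) by (simp add: \<kappa>_def)
  have "1 / 2 + 1 / (3 * \<gamma>3 * (1 - \<beta>)) > 0" using assms(4,10) by (intro add_pos_pos) auto
  then have c: "c > 0" using \<kappa> by (simp add: c_def)
  have "0 < 1 / \<omega>" using assms(5) by simp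
  then have \<gamma>2: "\<gamma>2 > 0" using assms(8) by linarith
  have \<omega>\<gamma>: "\<omega> * \<gamma>2 > 1" using assms(5,8) by (simp add: field_simps)
  have "C > 0"
    unfolding C_def using assms(1,3,5) \<gamma>2 \<omega>\<gamma> c by (intro add_pos_nonneg) (auto simp: B_def)
  show ?thesis
  \<comment> \<open>\<open>C\<close> governs the iterations with large trial gradient; the added 1
    leaves room for one more, since \<open>bound \<ge> 1\<close>.\<close>
  proof (intro exI[of _ "C + 1"] conjI allI impI)
    show "C + 1 > 0" using \<open>C > 0\<close> by simp
  next
    fix n :: nat and f :: "real vec \<Rightarrow> real" and L r1 \<Delta>f \<epsilon> :: real and x1 x d \<delta> r
    assume diff: "twice_differentiable n f" and bdd: "bdd_below (f ` carrier_vec n)" and L: "L > 0"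
      and lip: "lipschitz_hessian n L f" and x1: "x1 \<in> carrier_vec n" and r1: "r1 > 0"
      and \<Delta>f: "\<Delta>f = f x1 - (INF y\<in>carrier_vec n. f y)" "\<Delta>f > 0"
      and run: "CAT_run n f \<theta> \<beta> \<omega> \<gamma>1 \<gamma>2 \<gamma>3 x1 r1 x d \<delta> r" and \<epsilon>: "\<epsilon> > 0"
    note run = run[unfolded CAT_run_def]
    define a where "a = sqrt (\<epsilon> / (c * L))"
    define bound where "bound = \<Delta>f * L powr (1/2) / \<epsilon> powr (3/2)
        + ln (\<epsilon> powr (1/2) / (L powr (1/2) * r1) + r1 * \<epsilon> / \<Delta>f + 1) + 1"
    have a: "a > 0" using \<epsilon> c L by (simp add: a_def)
    have bound: "bound \<ge> 1"
      using \<Delta>f(2) r1 \<epsilon> by (simp add: bound_def add_nonneg_nonneg)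
    have large_count: "real K \<le> C * bound"
      if large: "\<And>k. 1 \<le> k \<Longrightarrow> k \<le> K \<Longrightarrow> \<epsilon> < vec_norm (gradient n f (x k + d k))" for K
    proof -
      have xd: "x k \<in> carrier_vec n" "d k \<in> carrier_vec n" "\<delta> k \<ge> 0" if "1 \<le> k" for k
        using run that by auto
      have inexact: "vec_norm (gradient n (quad_model n f (x k)) (d k) + \<delta> k \<cdot>\<^sub>v d k)
          \<le> \<gamma>1 * vec_norm (gradient n f (x k + d k))" if "1 \<le> k" for k
        using run that by auto
      have model: "quad_model n f (x k) (d k) \<le> - \<gamma>3 * (\<delta> k / 2) * (vec_norm (d k))\<^sup>2" if "1 \<le> k" for k
        using run that by auto
      have radius: "\<gamma>2 * \<delta> k * r k \<le> \<delta> k * vec_norm (d k)" "vec_norm (d k) \<le> r k" if "1 \<le> k" for k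
        using run that by auto
      have x_Suc: "x (Suc k) = (if f (x k + d k) \<le> f (x k) then x k + d k else x k)"
        and r_Suc: "r (Suc k) = (if rho_hat n f \<theta> (x k) (d k) \<ge> \<beta> then \<omega> * vec_norm (d k)
          else vec_norm (d k) / \<omega>)" if "1 \<le> k" for k
        using run that by auto
      \<comment> \<open>A zero step would reduce the gradient bound to
        \<open>?g \<le> \<gamma>1 * ?g\<close>, impossible for \<open>\<gamma>1 < 1\<close> and
        \<open>?g > 0\<close>.\<close>
      have D: "0 < vec_norm (d k)" if k: "1 \<le> k" "k \<le> K" for k
      proof (rule ccontr)
        let ?g = "vec_norm (gradient n f (x k + d k))"
        assume "\<not> 0 < vec_norm (d k)"
        then have "vec_norm (d k) = 0" using vec_norm_nonneg[of "d k"] by linarith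
        then have "?g \<le> \<gamma>1 * ?g"
          using CAT_gradient_bound[OF diff lip L xd[OF k(1)] inexact[OF k(1)]] by simp
        moreover have "?g > 0" using large[OF k] \<epsilon> by simp
        ultimately show False using assms(7) by simp
      qed
      have long: "a \<le> vec_norm (d k)"
        if k: "1 \<le> k" "k \<le> K" and short: "\<delta> k = 0 \<or> rho_hat n f \<theta> (x k) (d k) < \<beta>" for k
      proof -
        let ?g = "vec_norm (gradient n f (x k + d k))"
        have "?g > 0" using large[OF k] \<epsilon> by simp
        then have "\<kappa> * ?g \<le> (1 / 2 + 1 / (3 * \<gamma>3 * (1 - \<beta>))) * L * (vec_norm (d k))\<^sup>2"
          unfolding \<kappa>_def
          using CAT_short_step[OF diff lip L xd[OF k(1)] inexact[OF k(1)] model[OF k(1)]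
              assms(1,3,4,10) _ D[OF k] short] by blast
        then have "?g \<le> c * L * (vec_norm (d k))\<^sup>2"
          using \<kappa> by (simp add: c_def field_simps)
        then have "\<epsilon> \<le> c * L * (vec_norm (d k))\<^sup>2" using large[OF k] by linarith
        then have "\<epsilon> / (c * L) \<le> (vec_norm (d k))\<^sup>2"
          using c L by (simp add: pos_divide_le_eq mult.commute)
        then show ?thesis unfolding a_def by (intro real_le_lsqrt) auto
      qed
      have "real K \<le> 2 * \<omega> / (\<beta> * \<theta> * \<epsilon> / 2 * \<gamma>2 * a) * (f (x 1) - (INF y\<in>carrier_vec n. f y)) + 2
          + max 0 (ln (a / (\<omega> * r 1))) / ln (\<omega> * \<gamma>2) + max 0 (ln (\<omega> * r 1 / a)) / ln \<omega>"
      proof (rule CAT_count_le[where D = "\<lambda>k. vec_norm (d k)" and F = "\<lambda>k. f (x k)"])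
        show "\<beta> * \<theta> * \<epsilon> / 2 > 0" using assms(1,3) \<epsilon> by simp
        show "r 1 > 0" using run r1 by simp
        show "(INF y\<in>carrier_vec n. f y) \<le> f (x k)" if "1 \<le> k" for k
          by (rule cINF_lower[OF bdd]) (use xd that in auto)
        show "0 < vec_norm (d k) \<and> vec_norm (d k) \<le> r k" if "1 \<le> k" "k \<le> K" for k
          using D radius that by auto
        fix k assume k: "1 \<le> k" "k \<le> K"
        show "f (x (Suc k)) \<le> f (x k) - \<beta> * \<theta> * \<epsilon> / 2 * vec_norm (d k) \<and>
              r (Suc k) = \<omega> * vec_norm (d k) \<and> (\<gamma>2 * r k \<le> vec_norm (d k) \<or> a \<le> vec_norm (d k)) \<or>
            f (x (Suc k)) \<le> f (x k) \<and> r (Suc k) = vec_norm (d k) / \<omega> \<and> a \<le> vec_norm (d k)"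
        proof (cases "rho_hat n f \<theta> (x k) (d k) \<ge> \<beta>")
          case False
          then have "f (x (Suc k)) \<le> f (x k)" "r (Suc k) = vec_norm (d k) / \<omega>" "a \<le> vec_norm (d k)"
            using x_Suc[OF k(1)] r_Suc[OF k(1)] long[OF k] by auto
          then show ?thesis by blast
        next
          case True
          let ?g = "vec_norm (gradient n f (x k + d k))"
          have "\<gamma>3 * (\<delta> k / 2) * (vec_norm (d k))\<^sup>2 \<ge> 0" using assms(10) xd[OF k(1)] by simp
          then have M: "quad_model n f (x k) (d k) \<le> 0" using model[OF k(1)] by linarith
          \<comment> \<open>Dropping the nonnegative model term from the denominator and replacing
            the trial gradient norm by \<open>\<epsilon>\<close> yields the rate
            \<open>\<beta> * \<theta> * \<epsilon> / 2\<close>.\<close>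
          have eD: "0 < \<theta> / 2 * \<epsilon> * vec_norm (d k)" using assms(1) \<epsilon> D[OF k] by simp
          also have gD: "\<theta> / 2 * \<epsilon> * vec_norm (d k) \<le> \<theta> / 2 * ?g * vec_norm (d k)"
            using assms(1) \<epsilon> large[OF k] D[OF k] by (intro mult_mono) auto
          finally have den: "- quad_model n f (x k) (d k) + \<theta> / 2 * ?g * vec_norm (d k) > 0"
            using M by linarith
          have "\<beta> * (\<theta> / 2 * \<epsilon> * vec_norm (d k))
              \<le> \<beta> * (- quad_model n f (x k) (d k) + \<theta> / 2 * ?g * vec_norm (d k))"
            using M gD assms(3) by (intro mult_left_mono) auto
          also have "\<dots> \<le> f (x k) - f (x k + d k)"
            using True den by (simp add: rho_hat_def pos_le_divide_eq)
          finally have dec: "f (x k + d k) \<le> f (x k) - \<beta> * \<theta> * \<epsilon> / 2 * vec_norm (d k)"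
            by (simp add: mult_ac)
          have "0 \<le> \<beta> * \<theta> * \<epsilon> / 2 * vec_norm (d k)" using assms(1,3) \<epsilon> by simp
          \<comment> \<open>Acceptance is decided by descent, not by the ratio, so descent has to be
            derived before \<open>x (Suc k)\<close> is known.\<close>
          then have "f (x k + d k) \<le> f (x k)" using dec by linarith
          then have "x (Suc k) = x k + d k" using x_Suc[OF k(1)] by simp
          moreover have "r (Suc k) = \<omega> * vec_norm (d k)" using r_Suc[OF k(1)] True by simp
          \<comment> \<open>For \<open>\<delta> k > 0\<close> the radius condition can be divided by
            \<open>\<delta> k\<close>; for \<open>\<delta> k = 0\<close> the length bound
            \<open>long\<close> applies instead.\<close>
          moreover have "\<gamma>2 * r k \<le> vec_norm (d k) \<or> a \<le> vec_norm (d k)"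
          proof (cases "\<delta> k = 0")
            case False
            then have "\<delta> k > 0" using xd[OF k(1)] by simp
            moreover have "\<delta> k * (\<gamma>2 * r k) \<le> \<delta> k * vec_norm (d k)"
              using radius(1)[OF k(1)] by (simp add: mult_ac)
            ultimately show ?thesis by simp
          qed (use long[OF k] in simp)
          ultimately show ?thesis using dec by simp
        qed
      qed (use assms a in auto)
      also have "f (x 1) - (INF y\<in>carrier_vec n. f y) = \<Delta>f" using run \<Delta>f by simp
      also have "r 1 = r1" using run by simp
      also have "2 * \<omega> / (\<beta> * \<theta> * \<epsilon> / 2 * \<gamma>2 * a) * \<Delta>f + 2
          + max 0 (ln (a / (\<omega> * r1))) / ln (\<omega> * \<gamma>2) + max 0 (ln (\<omega> * r1 / a)) / ln \<omega> \<le> C * bound"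
        unfolding C_def bound_def
        by (rule CAT_bound_arith[OF \<epsilon> L \<Delta>f(2) r1 c assms(3,1,5) \<gamma>2 \<omega>\<gamma> a_def B_def])
      finally show ?thesis .
    qed
    \<comment> \<open>If the first \<open>N\<close> trial gradients were all large,
      \<open>N \<le> C * bound\<close> and \<open>(C + 1) * bound < N + 1\<close> would give
      \<open>bound < 1\<close>.\<close>
    define N where "N = nat \<lfloor>(C + 1) * bound\<rfloor>"
    have CB: "0 \<le> C * bound" using \<open>C > 0\<close> bound by simp
    have N: "real N \<le> (C + 1) * bound" "(C + 1) * bound < real N + 1"
      using CB bound unfolding N_def by (simp_all add: algebra_simps) linarith+
    have "\<exists>k\<ge>1. k \<le> N \<and> vec_norm (gradient n f (x k + d k)) \<le> \<epsilon>"
    proof (rule ccontr)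
      assume "\<not> ?thesis"
      then have "real N \<le> C * bound" by (intro large_count) (meson not_le)
      then show False using N bound by (simp add: algebra_simps)
    qed
    then obtain k where k: "1 \<le> k" "k \<le> N" "vec_norm (gradient n f (x k + d k)) \<le> \<epsilon>" by blast
    then have "real k \<le> (C + 1) * bound" using N(1) by linarith
    with k show "\<exists>k\<ge>1. vec_norm (gradient n f (x k + d k)) \<le> \<epsilon> \<and>
        real k \<le> (C + 1) * (\<Delta>f * L powr (1/2) / \<epsilon> powr (3/2)
        + ln (\<epsilon> powr (1/2) / (L powr (1/2) * r1) + r1 * \<epsilon> / \<Delta>f + 1) + 1)"
      unfolding bound_def by blast
  qed
qed

end
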